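(* Let $(y_k),(g_k),(t_k),(s_k),(g_k^\Psi)$ be generated by the first-order meta-algorithm described in the context, under the assumptions stated there, and let $z_k,u_k,d_k,w_k$ be as defined in the context. Then for every $k=1,2,\dots$ $$\frac{\sum_{i=0}^{k-1} t_i\big(f(Ay_{i}) + \Psi(y_{i}) + f^*(g_i) + \Psi^*(g_i^\Psi)\big)}{\sum_{i=0}^{k-1} t_i} + d_k^*(-w_k) = \frac{\sum_{i=0}^{k-1} \Big( t_i\big(\Psi(y_{i}) - \Psi(s_{i}) - \langle A^*g_i, s_{i}-y_{i}\rangle\big) - D_h(s_{i},s_{i-1})\Big)}{\sum_{i=0}^{k-1} t_i}.$$ In particular, the following perturbed Fenchel duality property holds: $$f(Az_k) + \Psi(z_k) + f^*(u_k) + (\Psi+d_k)^*(-A^*u_k) \le \delta_k$$ for $$\delta_k = \frac{\sum_{i=0}^{k-1} \Big( t_i\big(\Psi(y_{i}) - \Psi(s_{i}) - \langle A^*g_i, s_{i}-y_{i}\rangle\big) - D_h(s_{i},s_{i-1})\Big)}{\sum_{i=0}^{k-1} t_i}.$$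
   Context: Setting. $E$ and $F$ are real vector spaces with continuous dual spaces $E^*,F^*$ and duality pairings $\langle\cdot,\cdot\rangle$; $A:E\to F$ is a linear mapping with adjoint $A^*:F^*\to E^*$; $f:F\to\mathbb{R}\cup\{\infty\}$ and $\Psi:E\to\mathbb{R}\cup\{\infty\}$ are closed convex functions with $\mathrm{dom}(\Psi)\subseteq \mathrm{dom}(\partial(f\circ A))$; $h:E\to\mathbb{R}\cup\{\infty\}$ is a convex differentiable reference function (not necessarily strictly convex) with $\mathrm{dom}(\Psi)\subseteq\overline{\mathrm{dom}(h)}$. For a function $\phi$, $\phi^*$ denotes its convex conjugate, $\phi^*(v)=\sup_x\{\langle v,x\rangle-\phi(x)\}$. The Bregman distance of $h$ is $D_h(s,z)=h(s)-h(z)-\langle\nabla h(z),s-z\rangle$ (equal to $+\infty$ when $s\notin\mathrm{dom}(h)$). First-order meta-algorithm. Input $s_{-1}\in\mathrm{dom}(\Psi)\cap\mathrm{dom}(h)$. For $k=0,1,2,\dots$: pick any $y_k\in\mathrm{dom}(\partial(f\circ A))$ and $g_k\in\partial f(Ay_k)$; pick $t_k>0$; pick $s_k\in\mathrm{argmin}_s\{t_k(\langle A^*g_k,s\rangle+\Psi(s))+D_h(s,s_{k-1})\}$. Standing assumption. At each iteration $k$ the minimizer $s_k$ exists and satisfies the optimality conditions $t_k(A^*g_k+g_k^\Psi)+\nabla h(s_k)-\nabla h(s_{k-1})=0$ for some $g_k^\Psi\in\partial\Psi(s_k)$; this $g_k^\Psi$ is fixed. Derived sequences, for $k\ge1$: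 $$z_k=\frac{\sum_{i=0}^{k-1}t_iy_i}{\sum_{i=0}^{k-1}t_i},\quad u_k=\frac{\sum_{i=0}^{k-1}t_ig_i}{\sum_{i=0}^{k-1}t_i},\quad w_k=\frac{\sum_{i=0}^{k-1}t_i(A^*g_i+g_i^\Psi)}{\sum_{i=0}^{k-1}t_i},\quad d_k(s)=\frac{D_h(s,s_{-1})}{\sum_{i=0}^{k-1}t_i}.$$ *)

theory Defs
  imports "HOL-Analysis.Analysis"
begin

class real_tvs = real_vector + topological_ab_group_add +
  assumes tendsto_scaleR_nhds_Pair:
    "LIM x (nhds a \<times>\<^sub>F nhds b). scaleR (fst x) (snd x) :> nhds (scaleR a b)"

instance real_normed_vector \<subseteq> real_tvs
proof
  fix a :: real and b :: 'a
  have "((\<lambda>x. fst x) \<longlongrightarrow> a) (nhds a \<times>\<^sub>F nhds b)" "((\<lambda>x. snd x) \<longlongrightarrow> b) (nhds a \<times>\<^sub>F nhds b)"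
    by (rule filterlim_fst, rule filterlim_snd)
  then show "LIM x (nhds a \<times>\<^sub>F nhds b). fst x *\<^sub>R snd x :> nhds (a *\<^sub>R b)"
    by (rule tendsto_scaleR)
qed

(* The pairing of v in the dual with x is the application v x. *)
definition cont_dual :: "('a::real_tvs \<Rightarrow> real) set" where
  "cont_dual = {v. linear v \<and> continuous_on UNIV v}"

(* The adjoint of A; it maps the dual of the codomain into the dual of the domain
   whenever A has an adjoint (in particular, when A is continuous). *)
definition dual_map :: "('a \<Rightarrow> 'b) \<Rightarrow> ('b \<Rightarrow> real) \<Rightarrow> 'a \<Rightarrow> real" where
  "dual_map A v = (\<lambda>x. v (A x))"

definition eff_dom :: "('a \<Rightarrow> ereal) \<Rightarrow> 'a set" where
  "eff_dom \<phi> = {x. \<phi> x < \<infinity>}"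

definition epi :: "('a \<Rightarrow> ereal) \<Rightarrow> ('a \<times> real) set" where
  "epi \<phi> = {(x, r). \<phi> x \<le> ereal r}"

(* Functions with values in the reals together with +infinity. *)
definition convex_fun :: "('a::real_tvs \<Rightarrow> ereal) \<Rightarrow> bool" where
  "convex_fun \<phi> \<longleftrightarrow> (\<forall>x. \<phi> x \<noteq> -\<infinity>) \<and> convex (epi \<phi>)"

definition closed_convex_fun :: "('a::real_tvs \<Rightarrow> ereal) \<Rightarrow> bool" where
  "closed_convex_fun \<phi> \<longleftrightarrow> convex_fun \<phi> \<and> closed (epi \<phi>)"

definition conjugate :: "('a \<Rightarrow> ereal) \<Rightarrow> ('a \<Rightarrow> real) \<Rightarrow> ereal" where
  "conjugate \<phi> v = (SUP x. ereal (v x) - \<phi> x)"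

definition subdiff :: "('a::real_tvs \<Rightarrow> ereal) \<Rightarrow> 'a \<Rightarrow> ('a \<Rightarrow> real) set" where
  "subdiff \<phi> x = {v \<in> cont_dual. \<phi> x < \<infinity> \<and> (\<forall>y. \<phi> x + ereal (v (y - x)) \<le> \<phi> y)}"

definition subdiff_dom :: "('a::real_tvs \<Rightarrow> ereal) \<Rightarrow> 'a set" where
  "subdiff_dom \<phi> = {x. subdiff \<phi> x \<noteq> {}}"

(* Gateaux differentiability at a point of the effective domain.  The finite limit forces
   h to be finite near z along every line through z. *)
definition has_gradient :: "('a::real_tvs \<Rightarrow> ereal) \<Rightarrow> ('a \<Rightarrow> real) \<Rightarrow> 'a \<Rightarrow> bool" where
  "has_gradient h v z \<longleftrightarrow> v \<in> cont_dual \<and> \<bar>h z\<bar> \<noteq> \<infinity> \<and>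
     (\<forall>d. ((\<lambda>r. (h (z + r *\<^sub>R d) - h z) / ereal r) \<longlongrightarrow> ereal (v d)) (at (0::real)))"

definition differentiable_fun :: "('a::real_tvs \<Rightarrow> ereal) \<Rightarrow> bool" where
  "differentiable_fun h \<longleftrightarrow> (\<forall>z\<in>eff_dom h. \<exists>v. has_gradient h v z)"

definition gradient :: "('a::real_tvs \<Rightarrow> ereal) \<Rightarrow> 'a \<Rightarrow> 'a \<Rightarrow> real" where
  "gradient h z = (THE v. has_gradient h v z)"

(* Used only for z in the effective domain of h; then the value is +infinity exactly when
   s lies outside that domain. *)
definition bregman :: "('a::real_tvs \<Rightarrow> ereal) \<Rightarrow> 'a \<Rightarrow> 'a \<Rightarrow> ereal" where
  "bregman h s z = h s - h z - ereal (gradient h z (s - z))"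

(* prev a s k is the iterate with index k - 1, where a is the iterate with index -1. *)
definition prev :: "'a \<Rightarrow> (nat \<Rightarrow> 'a) \<Rightarrow> nat \<Rightarrow> 'a" where
  "prev a s k = (case k of 0 \<Rightarrow> a | Suc j \<Rightarrow> s j)"

end

theory Submission
  imports Defs
begin

text \<open>
  Write \<open>S k\<close> for the iterate of index \<open>k - 1\<close>, so that \<open>S 0\<close> is the starting point, and put
  \<open>T = (\<Sum>i<k. t i)\<close>.

  The optimality condition says that the \<open>i\<close>-th step moves the gradient of \<open>h\<close> by exactly
  \<open>- t i * (A\<^sup>* g i + g\<Psi> i)\<close>. Summing the steps gives \<open>- T * w k = \<nabla>h(S k) - \<nabla>h(S 0)\<close>, and as
  \<open>T * d k\<close> is \<open>h\<close> minus its linearisation at \<open>S 0\<close>, the iterate \<open>S k\<close> maximises the expression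
  defining \<open>conjugate (d k) (- w k)\<close>. With \<open>e i = \<nabla>h(S i)(S i) - h(S i)\<close>, which is the conjugate
  of \<open>h\<close> at \<open>\<nabla>h(S i)\<close>, that conjugate therefore equals \<open>(e k - e 0) / T\<close>
  (\<open>conjugate_scaled_bregman\<close>). On the other hand one step of the method
  contributes \<open>- t i * (A\<^sup>* g i + g\<Psi> i)(s i) - bregman h (s i) (S i) = e (i + 1) - e i\<close>,
  and these contributions telescope to the same value. Equality in the
  Fenchel-Young inequality at the pairs \<open>(A (y i), g i)\<close> and \<open>(s i, g\<Psi> i)\<close>
  (\<open>conjugate_eq_at_subgradient\<close>) turns the remaining terms of one side of the identity into
  those of the other. Only the values \<open>\<Psi> (y i)\<close> may be infinite, and they
  occur in the same way on both sides.

  The perturbed duality inequality follows from the identity by convexity: \<open>f\<close>, \<open>\<Psi>\<close> and their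
  conjugates at the averages \<open>z k\<close>, \<open>u k\<close> and the average of the \<open>g\<Psi> i\<close> are bounded by the averages
  of the values, and the conjugate of the sum \<open>\<Psi> + d k\<close> is split along
  \<open>- A\<^sup>* u k = (w k - A\<^sup>* u k) + (- w k)\<close> by \<open>conjugate_add_le\<close>.
\<close>

section \<open>Convex functions and conjugates\<close>

text \<open>The support inequality rearranges to \<open>v y - \<phi> y \<le> v x - \<phi> x\<close>, so the supremum defining the
  conjugate is attained at \<open>x\<close>. The lemma serves both for the subgradients of \<open>f\<close> and \<open>\<Psi>\<close> and for
  the differences of gradients of \<open>h\<close> that support \<open>d k\<close>.\<close>

lemma conjugate_eq_if_supporting:
  assumes x: "\<phi> x = ereal r"
    and supp: "\<And>y. \<phi> x + ereal (v y - v x) \<le> \<phi> y"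
  shows "conjugate \<phi> v = ereal (v x - r)"
  unfolding conjugate_def
proof (rule antisym)
  show "(SUP y. ereal (v y) - \<phi> y) \<le> ereal (v x - r)"
  proof (rule SUP_least)
    fix y
    show "ereal (v y) - \<phi> y \<le> ereal (v x - r)"
      using supp[of y] x by (cases "\<phi> y") auto
  qed
  show "ereal (v x - r) \<le> (SUP y. ereal (v y) - \<phi> y)"
    by (rule SUP_upper2[of x]) (simp_all add: x)
qed

lemma conjugate_eq_at_subgradient:
  assumes "v \<in> subdiff \<phi> x" and x: "\<phi> x = ereal r"
  shows "conjugate \<phi> v = ereal (v x - r)"
proof (rule conjugate_eq_if_supporting[where \<phi> = \<phi> and x = x, OF x])
  fix y
  have "linear v" and "\<phi> x + ereal (v (y - x)) \<le> \<phi> y"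
    using assms by (auto simp: subdiff_def cont_dual_def)
  then show "\<phi> x + ereal (v y - v x) \<le> \<phi> y" by (simp add: linear_diff)
qed

lemma finite_at_subgradient:
  assumes "v \<in> subdiff \<phi> x" "convex_fun \<phi>"
  shows "\<exists>r. \<phi> x = ereal r"
  using assms by (cases "\<phi> x") (auto simp: subdiff_def convex_fun_def)

lemma convex_fun_weighted_average_le:
  fixes t :: "'i \<Rightarrow> real"
  assumes "convex_fun \<phi>" "finite I" and t: "\<And>i. i \<in> I \<Longrightarrow> t i \<ge> 0" and T: "sum t I > 0"
    and r: "\<And>i. i \<in> I \<Longrightarrow> \<phi> (x i) \<le> ereal (r i)"
  shows "\<phi> ((\<Sum>i\<in>I. t i *\<^sub>R x i) /\<^sub>R sum t I) \<le> ereal ((\<Sum>i\<in>I. t i * r i) / sum t I)"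
proof -
  have "convex (epi \<phi>)" using assms by (simp add: convex_fun_def)
  moreover have "(\<Sum>i\<in>I. t i / sum t I) = 1" using T by (simp flip: sum_divide_distrib)
  ultimately have "(\<Sum>i\<in>I. (t i / sum t I) *\<^sub>R (x i, r i)) \<in> epi \<phi>"
    using assms by (intro convex_sum) (auto simp: epi_def)
  also have "(\<Sum>i\<in>I. (t i / sum t I) *\<^sub>R (x i, r i)) =
      ((\<Sum>i\<in>I. t i *\<^sub>R x i) /\<^sub>R sum t I, (\<Sum>i\<in>I. t i * r i) / sum t I)"
    by (simp add: prod_eq_iff fst_sum snd_sum scaleR_sum_right sum_divide_distrib
        divide_inverse_commute sum_distrib_left mult.assoc)
  finally show ?thesis by (simp add: epi_def)
qed

text \<open>A conjugate is a supremum of affine functions of \<open>v\<close>, hence convex.\<close>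

lemma conjugate_weighted_average_le:
  fixes t :: "'i \<Rightarrow> real"
  assumes "\<And>i. i \<in> I \<Longrightarrow> t i \<ge> 0" and T: "sum t I > 0"
    and c: "\<And>i. i \<in> I \<Longrightarrow> conjugate \<phi> (v i) \<le> ereal (c i)"
  shows "conjugate \<phi> (\<lambda>x. (\<Sum>i\<in>I. t i * v i x) / sum t I) \<le> ereal ((\<Sum>i\<in>I. t i * c i) / sum t I)"
  unfolding conjugate_def
proof (rule SUP_least)
  fix x
  have le: "ereal (v i x) - \<phi> x \<le> ereal (c i)" if "i \<in> I" for i
    using c[OF that] SUP_upper[of x UNIV "\<lambda>x. ereal (v i x) - \<phi> x"]
    by (auto simp: conjugate_def intro: order_trans)
  obtain j where j: "j \<in> I" using T by fastforce
  show "ereal ((\<Sum>i\<in>I. t i * v i x) / sum t I) - \<phi> x \<le> ereal ((\<Sum>i\<in>I. t i * c i) / sum t I)"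
  proof (cases "\<phi> x")
    case (real r)
    have "(\<Sum>i\<in>I. t i * v i x) - sum t I * r = (\<Sum>i\<in>I. t i * (v i x - r))"
      by (simp add: sum_subtractf sum_distrib_right right_diff_distrib)
    also have "\<dots> \<le> (\<Sum>i\<in>I. t i * c i)"
      using le assms(1) by (intro sum_mono mult_left_mono) (auto simp: real)
    finally have "(\<Sum>i\<in>I. t i * v i x) / sum t I - r \<le> (\<Sum>i\<in>I. t i * c i) / sum t I"
      using divide_right_mono[of _ _ "sum t I"] T by (force simp: diff_divide_distrib)
    then show ?thesis by (simp add: real)
  next
    case MInf
    then show ?thesis using le[OF j] by simp
  qed simp
qed

text \<open>This is the elementary half of the formula for the conjugate of a sum as an infimal
  convolution.\<close>

lemma conjugate_add_le:
  assumes "\<And>x. \<phi> x \<noteq> -\<infinity>" "\<And>x. \<psi> x \<noteq> -\<infinity>"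
  shows "conjugate (\<lambda>x. \<phi> x + \<psi> x) (\<lambda>x. v x + w x) \<le> conjugate \<phi> v + conjugate \<psi> w"
proof -
  have "ereal (v x + w x) - (\<phi> x + \<psi> x) \<le> conjugate \<phi> v + conjugate \<psi> w" for x
  proof -
    have "ereal (v x + w x) - (\<phi> x + \<psi> x) = (ereal (v x) - \<phi> x) + (ereal (w x) - \<psi> x)"
      using assms[of x] by (cases "\<phi> x"; cases "\<psi> x") auto
    also have "\<dots> \<le> conjugate \<phi> v + conjugate \<psi> w"
      unfolding conjugate_def by (intro add_mono SUP_upper) auto
    finally show ?thesis .
  qed
  then show ?thesis unfolding conjugate_def[of "\<lambda>x. \<phi> x + \<psi> x"] by (rule SUP_least)
qed

section \<open>Gradients and Bregman distances\<close>

lemma has_gradient_unique: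
  assumes "has_gradient h v z" "has_gradient h v' z"
  shows "v = v'"
proof
  fix d
  show "v d = v' d"
    using assms tendsto_unique[of "at (0::real)" "\<lambda>r. (h (z + r *\<^sub>R d) - h z) / ereal r"]
    by (auto simp: has_gradient_def)
qed

lemma has_gradient_gradient:
  assumes "differentiable_fun h" "z \<in> eff_dom h"
  shows "has_gradient h (gradient h z) z"
  unfolding gradient_def using assms
  by (metis (mono_tags) differentiable_fun_def has_gradient_unique theI)

lemma convex_fun_segment_le:
  assumes "convex_fun h" "h z = ereal a" "h x = ereal b" "0 \<le> r" "r \<le> 1"
  shows "h (z + r *\<^sub>R (x - z)) \<le> ereal (a + r * (b - a))"
proof -
  have "(1 - r) *\<^sub>R (z, a) + r *\<^sub>R (x, b) \<in> epi h"
    using assms by (intro convexD) (auto simp: convex_fun_def epi_def)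
  also have "(1 - r) *\<^sub>R (z, a) + r *\<^sub>R (x, b) = (z + r *\<^sub>R (x - z), a + r * (b - a))"
    by (simp add: algebra_simps)
  finally show ?thesis by (simp add: epi_def)
qed

text \<open>By convexity the difference quotients along a segment starting at \<open>z\<close> are at most the
  increment of \<open>h\<close> over the whole segment, and the gradient is their limit.\<close>

lemma convex_fun_above_tangent:
  assumes cv: "convex_fun h" and gr: "has_gradient h v z"
  shows "h z + ereal (v x - v z) \<le> h x"
proof -
  have lin: "linear v" using gr by (auto simp: has_gradient_def cont_dual_def)
  obtain a where a: "h z = ereal a" using gr by (cases "h z") (auto simp: has_gradient_def)
  show ?thesis
  proof (cases "h x")
    case (real b)
    let ?q = "\<lambda>r. (h (z + r *\<^sub>R (x - z)) - h z) / ereal r"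
    have "(?q \<longlongrightarrow> ereal (v (x - z))) (at_right 0)"
      using gr by (auto simp: has_gradient_def intro: filterlim_mono[OF _ order_refl at_le])
    moreover have "eventually (\<lambda>r. ?q r \<le> ereal (b - a)) (at_right 0)"
      using eventually_at_right_real[of 0 1, simplified]
    proof eventually_elim
      case (elim r)
      then have "h (z + r *\<^sub>R (x - z)) \<le> ereal (a + r * (b - a))"
        using convex_fun_segment_le[OF cv a real] by simp
      then show ?case
        using elim by (cases "h (z + r *\<^sub>R (x - z))") (auto simp: a field_simps)
    qed
    ultimately have "ereal (v (x - z)) \<le> ereal (b - a)"
      by (intro tendsto_upperbound) auto
    then show ?thesis by (simp add: a real linear_diff[OF lin])
  qed (use cv in \<open>auto simp: convex_fun_def\<close>)
qed

text \<open>Up to an affine function \<open>bregman h _ a\<close> is \<open>h\<close> itself, so a difference of gradients supports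
  it where the gradient of \<open>h\<close> supports \<open>h\<close>, that is, at \<open>p\<close>.\<close>

lemma conjugate_scaled_bregman:
  assumes cv: "convex_fun h" and df: "differentiable_fun h" and T: "T > 0"
    and a: "h a = ereal ha" and p: "h p = ereal hp"
  shows "conjugate (\<lambda>x. bregman h x a / ereal T) (\<lambda>x. (gradient h p x - gradient h a x) / T)
    = ereal (((gradient h p p - hp) - (gradient h a a - ha)) / T)"
proof -
  let ?v = "\<lambda>x. (gradient h p x - gradient h a x) / T"
  have ga: "has_gradient h (gradient h a) a" and gp: "has_gradient h (gradient h p) p"
    using df a p by (auto simp: eff_dom_def intro: has_gradient_gradient)
  have lin: "gradient h a (x - a) = gradient h a x - gradient h a a" for x
    using ga by (auto simp: has_gradient_def cont_dual_def linear_diff)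
  have "conjugate (\<lambda>x. bregman h x a / ereal T) ?v
      = ereal (?v p - (hp - ha - gradient h a (p - a)) / T)"
  proof (rule conjugate_eq_if_supporting)
    show bp: "bregman h p a / ereal T = ereal ((hp - ha - gradient h a (p - a)) / T)"
      using T by (simp add: bregman_def a p)
    fix x
    have "h p + ereal (gradient h p x - gradient h p p) \<le> h x"
      by (rule convex_fun_above_tangent[OF cv gp])
    then show "bregman h p a / ereal T + ereal (?v x - ?v p) \<le> bregman h x a / ereal T"
      using T by (cases "h x")
        (auto simp: bp bregman_def a p lin divide_right_mono
          simp flip: add_divide_distrib diff_divide_distrib)
  qed
  also have "\<dots> = ereal (((gradient h p p - hp) - (gradient h a a - ha)) / T)"
    using T by (simp add: lin field_simps)
  finally show ?thesis .
qed

section \<open>The iterates of the meta-algorithm\<close>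

text \<open>Outside the domain of \<open>h\<close> the objective is infinite, while at the previous iterate
  it is finite, so no minimiser lies there. This is what gives \<open>gradient h\<close> a meaning at the
  iterates.\<close>

lemma iterates_in_eff_dom:
  assumes h: "convex_fun h" "s_init \<in> eff_dom h"
    and \<Psi>: "\<And>k. \<bar>\<Psi> (prev s_init s k)\<bar> \<noteq> \<infinity>"
    and t: "\<And>k. t k > 0"
    and argmin: "\<And>k. is_arg_min
           (\<lambda>x. ereal (t k) * (ereal (l k x) + \<Psi> x) + bregman h x (prev s_init s k))
           (\<lambda>_. True) (s k)"
  shows "prev s_init s k \<in> eff_dom h"
proof (induction k)
  case 0
  show ?case using h by (simp add: prev_def)
next
  case (Suc k)
  let ?p = "prev s_init s k"
  have s: "prev s_init s (Suc k) = s k" by (simp add: prev_def)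
  obtain hp where hp: "h ?p = ereal hp"
    using Suc h by (cases "h ?p") (auto simp: eff_dom_def convex_fun_def)
  obtain a where a: "\<Psi> ?p = ereal a" using \<Psi>[of k] by auto
  obtain b where b: "\<Psi> (s k) = ereal b" using \<Psi>[of "Suc k"] by (auto simp: s)
  have "\<not> ereal (t k) * (ereal (l k ?p) + \<Psi> ?p) + bregman h ?p ?p
        < ereal (t k) * (ereal (l k (s k)) + \<Psi> (s k)) + bregman h (s k) ?p"
    using argmin[of k] by (auto simp: is_arg_min_def)
  then have "h (s k) \<noteq> \<infinity>" by (auto simp: bregman_def hp a b)
  then show ?case by (simp add: s eff_dom_def less_top[symmetric] top_ereal_def)
qed


theorem theorem1:
  fixes A :: "'e::real_tvs \<Rightarrow> 'f::real_tvs"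
    and f :: "'f \<Rightarrow> ereal"
    and \<Psi> h :: "'e \<Rightarrow> ereal"
    and s_init :: 'e
    and y s z :: "nat \<Rightarrow> 'e"
    and g u :: "nat \<Rightarrow> 'f \<Rightarrow> real"
    and g\<Psi> w :: "nat \<Rightarrow> 'e \<Rightarrow> real"
    and t :: "nat \<Rightarrow> real"
    and d :: "nat \<Rightarrow> 'e \<Rightarrow> ereal"
    and \<delta> :: "nat \<Rightarrow> ereal"
  assumes "linear A"
    and "\<forall>v\<in>cont_dual. dual_map A v \<in> cont_dual"
    and "closed_convex_fun f"
    and "closed_convex_fun \<Psi>"
    and "eff_dom \<Psi> \<subseteq> subdiff_dom (f \<circ> A)"
    and "convex_fun h"
    and "differentiable_fun h"
    and "eff_dom \<Psi> \<subseteq> closure (eff_dom h)"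
    and "s_init \<in> eff_dom \<Psi> \<inter> eff_dom h"
    and "\<And>k. y k \<in> subdiff_dom (f \<circ> A)"
    and "\<And>k. g k \<in> subdiff f (A (y k))"
    and "\<And>k. t k > 0"
    and "\<And>k. is_arg_min
               (\<lambda>x. ereal (t k) * (ereal (dual_map A (g k) x) + \<Psi> x) + bregman h x (prev s_init s k))
               (\<lambda>_. True) (s k)"
    and "\<And>k. g\<Psi> k \<in> subdiff \<Psi> (s k)"
    and "\<And>k x. t k * (dual_map A (g k) x + g\<Psi> k x)
               + gradient h (s k) x - gradient h (prev s_init s k) x = 0"
    and z: "\<And>k. k \<ge> 1 \<Longrightarrow> z k = (\<Sum>i<k. t i *\<^sub>R y i) /\<^sub>R (\<Sum>i<k. t i)"
    and u: "\<And>k v. k \<ge> 1 \<Longrightarrow> u k v = (\<Sum>i<k. t i * g i v) / (\<Sum>i<k. t i)"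
    and w: "\<And>k x. k \<ge> 1 \<Longrightarrow>
               w k x = (\<Sum>i<k. t i * (dual_map A (g i) x + g\<Psi> i x)) / (\<Sum>i<k. t i)"
    and d: "\<And>k x. k \<ge> 1 \<Longrightarrow> d k x = bregman h x s_init / ereal (\<Sum>i<k. t i)"
    and \<delta>: "\<And>k. k \<ge> 1 \<Longrightarrow> \<delta> k =
               (\<Sum>i<k. ereal (t i) * (\<Psi> (y i) - \<Psi> (s i) - ereal (dual_map A (g i) (s i - y i)))
                     - bregman h (s i) (prev s_init s i)) / ereal (\<Sum>i<k. t i)"
  shows "\<forall>k\<ge>1.
      (\<Sum>i<k. ereal (t i) * (f (A (y i)) + \<Psi> (y i) + conjugate f (g i) + conjugate \<Psi> (g\<Psi> i)))
          / ereal (\<Sum>i<k. t i)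
        + conjugate (d k) (\<lambda>x. - w k x) = \<delta> k
    \<and> f (A (z k)) + \<Psi> (z k) + conjugate f (u k)
        + conjugate (\<lambda>x. \<Psi> x + d k x) (\<lambda>x. - dual_map A (u k) x) \<le> \<delta> k"
proof (intro allI impI)
  note cf = \<open>closed_convex_fun f\<close> and c\<Psi> = \<open>closed_convex_fun \<Psi>\<close>
  note ch = \<open>convex_fun h\<close> and dh = \<open>differentiable_fun h\<close>
  note g = \<open>\<And>k. g k \<in> subdiff f (A (y k))\<close> and g\<Psi> = \<open>\<And>k. g\<Psi> k \<in> subdiff \<Psi> (s k)\<close>
  note t = \<open>\<And>k. t k > 0\<close>
  have cvf: "convex_fun f" and cv\<Psi>: "convex_fun \<Psi>"
    using cf c\<Psi> by (simp_all add: closed_convex_fun_def)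
  define S where "S = prev s_init s"
  define G where "G i = gradient h (S i)" for i
  have S_0: "S 0 = s_init" and S_Suc: "S (Suc i) = s i" for i
    by (simp_all add: S_def prev_def)

  obtain \<phi> where \<phi>: "\<And>i. f (A (y i)) = ereal (\<phi> i)"
    using finite_at_subgradient[OF g cvf] by metis
  obtain \<psi> where \<psi>: "\<And>i. \<Psi> (s i) = ereal (\<psi> i)"
    using finite_at_subgradient[OF g\<Psi> cv\<Psi>] by metis
  have "\<bar>\<Psi> (prev s_init s i)\<bar> \<noteq> \<infinity>" for i
  proof (cases i)
    case 0
    then show ?thesis
      using \<open>s_init \<in> eff_dom \<Psi> \<inter> eff_dom h\<close> cv\<Psi> by (auto simp: prev_def eff_dom_def convex_fun_def)
  qed (simp add: prev_def \<psi>)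
  then have S_dom: "S i \<in> eff_dom h" for i
    unfolding S_def using assms(9) by (intro iterates_in_eff_dom[OF ch _ _ t assms(13)]) auto
  have "\<exists>r. h (S i) = ereal r" for i
    using S_dom[of i] ch by (cases "h (S i)") (auto simp: eff_dom_def convex_fun_def)
  then obtain \<eta> where \<eta>: "\<And>i. h (S i) = ereal (\<eta> i)" by metis
  have linG: "linear (G i)" for i
    using has_gradient_gradient[OF dh S_dom, of i]
    by (simp add: G_def has_gradient_def cont_dual_def)

  have step: "t i * (g i (A x) + g\<Psi> i x) = G i x - G (Suc i) x" for i x
    using assms(15)[of i x] by (simp add: G_def S_Suc flip: S_def) (simp add: dual_map_def)
  have D: "bregman h (s i) (S i) = ereal (\<eta> (Suc i) - \<eta> i - G i (s i - S i))" for i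
    using \<eta>[of "Suc i"] \<eta>[of i] by (simp add: bregman_def G_def S_Suc)
  have conj_f: "conjugate f (g i) = ereal (g i (A (y i)) - \<phi> i)" for i
    by (rule conjugate_eq_at_subgradient[OF g \<phi>])
  have conj_\<Psi>: "conjugate \<Psi> (g\<Psi> i) = ereal (g\<Psi> i (s i) - \<psi> i)" for i
    by (rule conjugate_eq_at_subgradient[OF g\<Psi> \<psi>])
  have lin_gA: "g i (A (s i - y i)) = g i (A (s i)) - g i (A (y i))" for i
    using g[of i] \<open>linear A\<close> by (simp add: subdiff_def cont_dual_def linear_diff)

  fix k :: nat
  assume k: "k \<ge> 1"
  define T where "T = (\<Sum>i<k. t i)"
  have T: "T > 0" unfolding T_def using k t by (intro sum_pos) (auto simp: lessThan_empty_iff)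

  define e where "e i = G i (S i) - \<eta> i" for i
  have wk: "- w k x = (G k x - G 0 x) / T" for x
  proof -
    have "(\<Sum>i<k. t i * (g i (A x) + g\<Psi> i x)) = G 0 x - G k x"
      using sum_lessThan_telescope'[of "\<lambda>i. G i x" k] by (simp add: step)
    then show ?thesis by (simp add: w[OF k] dual_map_def minus_divide_left flip: T_def)
  qed
  have conj_d: "conjugate (d k) (\<lambda>x. - w k x) = ereal ((e k - e 0) / T)"
  proof -
    have "d k = (\<lambda>x. bregman h x (S 0) / ereal T)" using d[OF k] by (simp add: S_0 T_def fun_eq_iff)
    then show ?thesis
      using conjugate_scaled_bregman[OF ch dh T \<eta> \<eta>, of 0 k] by (simp add: wk G_def e_def)
  qed

  \<comment> \<open>Both sums are split into the possibly infinite part \<open>P\<close> and a finite remainder; the two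
    remainders differ by a telescoping sum.\<close>
  define P where "P = (\<Sum>i<k. ereal (t i) * \<Psi> (y i))"
  define a where "a i = t i * (g i (A (y i)) + g\<Psi> i (s i) - \<psi> i)" for i
  define b where "b i = a i + (e (Suc i) - e i)" for i
  have \<Psi>_y: "\<Psi> (y i) \<noteq> -\<infinity>" for i using cv\<Psi> by (simp add: convex_fun_def)
  have lhs: "(\<Sum>i<k. ereal (t i) * (f (A (y i)) + \<Psi> (y i) + conjugate f (g i) + conjugate \<Psi> (g\<Psi> i)))
      = P + ereal (\<Sum>i<k. a i)"
  proof -
    have "ereal (t i) * (f (A (y i)) + \<Psi> (y i) + conjugate f (g i) + conjugate \<Psi> (g\<Psi> i))
        = ereal (t i) * \<Psi> (y i) + ereal (a i)" for i
      using \<Psi>_y[of i] t[of i]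
      by (cases "\<Psi> (y i)") (simp_all add: \<phi> conj_f conj_\<Psi> a_def algebra_simps)
    then show ?thesis by (simp add: P_def sum.distrib)
  qed
  have \<delta>k: "\<delta> k = (P + ereal (\<Sum>i<k. b i)) / ereal T"
  proof -
    have "ereal (t i) * (\<Psi> (y i) - \<Psi> (s i) - ereal (dual_map A (g i) (s i - y i)))
          - bregman h (s i) (S i) = ereal (t i) * \<Psi> (y i) + ereal (b i)" for i
      using \<Psi>_y[of i] t[of i] step[of i "s i"]
      by (cases "\<Psi> (y i)")
        (simp_all add: D \<psi> dual_map_def lin_gA b_def a_def e_def S_Suc linear_diff[OF linG] algebra_simps)
    then show ?thesis by (simp add: \<delta>[OF k] P_def T_def sum.distrib flip: S_def)
  qed
  have sum_b: "(\<Sum>i<k. b i) = (\<Sum>i<k. a i) + (e k - e 0)"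
    by (simp add: b_def sum.distrib sum_lessThan_telescope)
  have identity: "(\<Sum>i<k. ereal (t i) *
        (f (A (y i)) + \<Psi> (y i) + conjugate f (g i) + conjugate \<Psi> (g\<Psi> i))) / ereal T
      + conjugate (d k) (\<lambda>x. - w k x) = \<delta> k"
    unfolding lhs \<delta>k conj_d sum_b using T by (cases P) (simp_all add: field_simps)

  have "f (A (z k)) + \<Psi> (z k) + conjugate f (u k)
        + conjugate (\<lambda>x. \<Psi> x + d k x) (\<lambda>x. - dual_map A (u k) x) \<le> \<delta> k"
  proof (cases "\<exists>i<k. \<Psi> (y i) = \<infinity>")
    case True
    then have "P = \<infinity>" using t by (auto simp: P_def sum_Pinfty)
    then show ?thesis using T by (simp add: \<delta>k)
  next
    case False
    then have "\<exists>r. \<Psi> (y i) = ereal r" if "i < k" for i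
      using \<Psi>_y[of i] that by (cases "\<Psi> (y i)") auto
    then obtain p where p: "\<And>i. i < k \<Longrightarrow> \<Psi> (y i) = ereal (p i)" by metis
    have t0: "\<And>i. 0 \<le> t i" using t less_imp_le by blast
    define v where "v x = (\<Sum>i<k. t i * g\<Psi> i x) / T" for x
    have Az: "A (z k) = (\<Sum>i<k. t i *\<^sub>R A (y i)) /\<^sub>R T"
      using \<open>linear A\<close> by (simp add: z[OF k] linear_scale linear_sum flip: T_def)
    have f_z: "f (A (z k)) \<le> ereal ((\<Sum>i<k. t i * \<phi> i) / T)"
      unfolding Az T_def using T t0
      by (intro convex_fun_weighted_average_le[OF cvf]) (auto simp: \<phi> T_def)
    have \<Psi>_z: "\<Psi> (z k) \<le> ereal ((\<Sum>i<k. t i * p i) / T)"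
      unfolding z[OF k] T_def using T t0
      by (intro convex_fun_weighted_average_le[OF cv\<Psi>]) (auto simp: p T_def)
    have "u k = (\<lambda>x. (\<Sum>i<k. t i * g i x) / T)" by (simp add: u[OF k] T_def fun_eq_iff)
    then have f_u: "conjugate f (u k) \<le> ereal ((\<Sum>i<k. t i * (g i (A (y i)) - \<phi> i)) / T)"
      using T t0 unfolding T_def by (auto intro!: conjugate_weighted_average_le simp: conj_f)
    have \<Psi>_v: "conjugate \<Psi> v \<le> ereal ((\<Sum>i<k. t i * (g\<Psi> i (s i) - \<psi> i)) / T)"
      using T t0 unfolding T_def v_def by (intro conjugate_weighted_average_le) (auto simp: conj_\<Psi>)
    have split: "- dual_map A (u k) x = v x + - w k x" for x
      by (simp add: v_def dual_map_def u[OF k] w[OF k] distrib_left sum.distrib add_divide_distrib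
          flip: T_def)
    have d_not_MInf: "d k x \<noteq> -\<infinity>" for x
      using T ch \<eta>[of 0] by (cases "h x") (auto simp: d[OF k] bregman_def S_0 convex_fun_def simp flip: T_def)
    have "conjugate (\<lambda>x. \<Psi> x + d k x) (\<lambda>x. - dual_map A (u k) x)
        \<le> conjugate \<Psi> v + conjugate (d k) (\<lambda>x. - w k x)"
      unfolding split using cv\<Psi> d_not_MInf by (intro conjugate_add_le) (auto simp: convex_fun_def)
    also have "\<dots> \<le> ereal ((\<Sum>i<k. t i * (g\<Psi> i (s i) - \<psi> i)) / T) + ereal ((e k - e 0) / T)"
      unfolding conj_d by (intro add_mono \<Psi>_v order_refl)
    finally have "f (A (z k)) + \<Psi> (z k) + conjugate f (u k)
        + conjugate (\<lambda>x. \<Psi> x + d k x) (\<lambda>x. - dual_map A (u k) x)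
      \<le> ereal ((\<Sum>i<k. t i * \<phi> i) / T) + ereal ((\<Sum>i<k. t i * p i) / T)
        + ereal ((\<Sum>i<k. t i * (g i (A (y i)) - \<phi> i)) / T)
        + (ereal ((\<Sum>i<k. t i * (g\<Psi> i (s i) - \<psi> i)) / T) + ereal ((e k - e 0) / T))"
      by (intro add_mono f_z \<Psi>_z f_u)
    also have "\<dots> = \<delta> k"
    proof -
      have "P = ereal (\<Sum>i<k. t i * p i)" by (simp add: P_def p)
      then show ?thesis using T
        by (simp add: \<delta>k sum_b a_def sum.distrib sum_subtractf algebra_simps
            flip: add_divide_distrib diff_divide_distrib)
    qed
    finally show ?thesis .
  qed
  with identity show "(\<Sum>i<k. ereal (t i) *
        (f (A (y i)) + \<Psi> (y i) + conjugate f (g i) + conjugate \<Psi> (g\<Psi> i))) / ereal (\<Sum>i<k. t i)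
      + conjugate (d k) (\<lambda>x. - w k x) = \<delta> k
    \<and> f (A (z k)) + \<Psi> (z k) + conjugate f (u k)
        + conjugate (\<lambda>x. \<Psi> x + d k x) (\<lambda>x. - dual_map A (u k) x) \<le> \<delta> k"
    by (simp add: T_def)
qed

end
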